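(* Let $1\le k<N$, let $v(i)$ be the $i$-th row of the matrix $V_k$ formed by the top $k$ (column) eigenvectors of $A$, and let $\tilde v(i)$ be the $i$-th row of the matrix $\tilde V_k$ formed by the top $k$ eigenvectors of $\tilde A$. Let $\alpha>0$. If $\lambda_k-\lambda_{k+1}\ge\alpha$ and $\lambda_k\ge\alpha$, then for every $i\in\{1,\dots,N\}$ $$\|\tilde v(i)-v(i)Q\|_2\le(1+\sqrt2)\,\frac1\alpha\,\|A-\tilde A\|_F ,$$ where $Q$ is the $k\times k$ orthogonal matrix that minimizes $\|\tilde V_k-V_kQ\|_F$ over all $k\times k$ orthogonal matrices.
   Context: Let $\sigma>0$, let $x_1,\dots,x_N$ be data points in a Euclidean space, and let $\tilde x_1,\dots,\tilde x_N$ be perturbed data points, also in a Euclidean space (possibly of different dimension). Define the $N\times N$ matrices $W_{i,j}=\exp\left(-\frac{\|x_i-x_j\|_2^2}{2\sigma}\right)$ and $\tilde W_{i,j}=\exp\left(-\frac{\|\tilde x_i-\tilde x_j\|_2^2}{2\sigma}\right)$, the diagonal matrices $D_{i,i}=\sum_{l=1}^N W_{i,l}$ and $\tilde D_{i,i}=\sum_{l=1}^N\tilde W_{i,l}$, and the real symmetric affinity matrices $A=D^{-1/2}WD^{-1/2}$ and $\tilde A=\tilde D^{-1/2}\tilde W\tilde D^{-1/2}$. Let $\lambda_1\ge\lambda_2\ge\dots\ge\lambda_N$ be the eigenvalues of $A$ with corresponding orthonormal eigenvectors $v_1,\dots,v_N$, and let $\tilde v_1,\dots,\tilde v_N$ be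 orthonormal eigenvectors of $\tilde A$, ordered by decreasing eigenvalue. Put $V_k=[v_1,\dots,v_k]\in\mathbb{R}^{N\times k}$ and $\tilde V_k=[\tilde v_1,\dots,\tilde v_k]\in\mathbb{R}^{N\times k}$. For (row) vectors $\|\cdot\|_2$ is the Euclidean norm; $\|\cdot\|_F$ is the Frobenius norm. *)

theory Defs
  imports "HOL-Analysis.Analysis" "Jordan_Normal_Form.Char_Poly"
begin

text \<open>All indices start at 0: the eigenvalues $\lambda_k$ and $\lambda_{k+1}$ of the usual
  1-based numbering are \<open>lam (k - 1)\<close> and \<open>lam k\<close>.\<close>

definition gaussian_mat :: "real \<Rightarrow> nat \<Rightarrow> (nat \<Rightarrow> 'a::euclidean_space) \<Rightarrow> real mat" where
  "gaussian_mat \<sigma> N x = mat N N (\<lambda>(i, j). exp (- ((norm (x i - x j))\<^sup>2 / (2 * \<sigma>))))"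

definition degree_mat :: "real mat \<Rightarrow> real mat" where
  "degree_mat W = mat_diag (dim_row W) (\<lambda>i. \<Sum>l<dim_col W. W $$ (i, l))"

text \<open>This is the matrix power $D^{-1/2}$ only for diagonal \<open>D\<close> with positive diagonal.\<close>

definition diag_inv_sqrt :: "real mat \<Rightarrow> real mat" where
  "diag_inv_sqrt D = mat_diag (dim_row D) (\<lambda>i. 1 / sqrt (D $$ (i, i)))"

definition affinity_mat :: "real \<Rightarrow> nat \<Rightarrow> (nat \<Rightarrow> 'a::euclidean_space) \<Rightarrow> real mat" where
  "affinity_mat \<sigma> N x =
     (let W = gaussian_mat \<sigma> N x; D = degree_mat W
      in diag_inv_sqrt D * W * diag_inv_sqrt D)"

text \<open>For \<open>A\<close> of size $N \times N$, the \<open>N\<close> orthonormal vectors form a basis, so \<open>lam\<close>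
  lists all eigenvalues of \<open>A\<close> with their multiplicities.\<close>

definition ordered_eigensystem :: "real mat \<Rightarrow> (nat \<Rightarrow> real) \<Rightarrow> (nat \<Rightarrow> real vec) \<Rightarrow> bool" where
  "ordered_eigensystem A lam v \<longleftrightarrow>
     (\<forall>j<dim_row A. eigenvector A (v j) (lam j)) \<and>
     (\<forall>i<dim_row A. \<forall>j<dim_row A. scalar_prod (v i) (v j) = (if i = j then 1 else 0)) \<and>
     (\<forall>i j. i \<le> j \<and> j < dim_row A \<longrightarrow> lam j \<le> lam i)"

definition top_eigenvectors :: "nat \<Rightarrow> nat \<Rightarrow> (nat \<Rightarrow> real vec) \<Rightarrow> real mat" where
  "top_eigenvectors N k v = mat_of_cols N (map v [0..<k])"

definition vec_norm2 :: "real vec \<Rightarrow> real" where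
  "vec_norm2 u = sqrt (scalar_prod u u)"

definition frobenius_norm :: "real mat \<Rightarrow> real" where
  "frobenius_norm M = sqrt (\<Sum>i<dim_row M. \<Sum>j<dim_col M. (M $$ (i, j))\<^sup>2)"

text \<open>The library predicate \<open>orthogonal_mat\<close> does not require columns of unit length, and
  thus is not used here.\<close>

definition orthogonal_group_mats :: "nat \<Rightarrow> real mat set" where
  "orthogonal_group_mats k =
     {Q \<in> carrier_mat k k. transpose_mat Q * Q = 1\<^sub>m k \<and> Q * transpose_mat Q = 1\<^sub>m k}"

text \<open>The minimizer need not be unique; this holds of every minimizer.\<close>

definition is_optimal_alignment :: "nat \<Rightarrow> real mat \<Rightarrow> real mat \<Rightarrow> real mat \<Rightarrow> bool" where
  "is_optimal_alignment k V V' Q \<longleftrightarrow>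
     is_arg_min (\<lambda>R. frobenius_norm (V' - V * R)) (\<lambda>R. R \<in> orthogonal_group_mats k) Q"

definition row_vec_mult :: "real vec \<Rightarrow> real mat \<Rightarrow> real vec" where
  "row_vec_mult u M = vec (dim_col M) (\<lambda>j. scalar_prod u (col M j))"

end

theory Submission
  imports Defs
begin

text \<open>The bound holds because already the whole matrix \<open>V' - V * Q\<close> has Frobenius norm at most
  \<open>2 / \<alpha>\<close> times that of \<open>A - A'\<close>; a row is no longer than the matrix, and $2 \le 1 + \sqrt 2$.
  The quantity through which everything passes is
  \<open>s = k - frob_inner (V\<^sup>T * V') (V\<^sup>T * V')\<close>, the sum of the squared sines of the principal
  angles between the two top eigenspaces. With the orthogonal projections \<open>P = V * V\<^sup>T\<close> and
  \<open>P' = V' * V'\<^sup>T\<close>, the squared Frobenius norm of \<open>P - P'\<close> is exactly \<open>2 * s\<close>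
  (\<open>projection_distance\<close>).

  First, the projections are close. Among all projections of rank \<open>k\<close>, the map
  \<open>X \<mapsto> frob_inner A X\<close> is maximal at \<open>P\<close>, and an eigenvalue gap \<open>\<alpha>\<close> makes it drop by at least
  \<open>\<alpha> * s\<close> from \<open>P\<close> to \<open>P'\<close> (\<open>ky_fan_gap\<close>). For \<open>A'\<close> the maximum is at \<open>P'\<close>, so
  \<open>frob_inner A' P \<le> frob_inner A' P'\<close>. Adding the two inequalities gives
  \<open>\<alpha> * s \<le> frob_inner (A - A') (P - P')\<close>, and Cauchy-Schwarz turns this into a linear bound on
  the norm of \<open>P - P'\<close> (\<open>davis_kahan_one_gap\<close>).

  Second, the aligned bases are as close as the projections: the squared norm of \<open>V' - V * Q\<close>
  is at most \<open>2 * s\<close> for every optimal \<open>Q\<close> (\<open>optimal_alignment_bound\<close>). Optimality of \<open>Q\<close> says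
  that the trace of \<open>S = Q\<^sup>T * (V\<^sup>T * V')\<close> does not grow when \<open>S\<close> is multiplied by an orthogonal
  matrix. Comparison with one Householder reflection shows that \<open>S\<close> is positive
  semidefinite, and comparison with products of two reflections shows that it is symmetric.
  Since \<open>S\<close> is also a contraction, its eigenvalues lie between 0 and 1, so its trace is at
  least its squared Frobenius norm, which is \<open>k - s\<close>. This replaces the
  usual argument by singular values.\<close>

unbundle no inner_syntax and no vec_syntax

section \<open>Vectors and isometries\<close>

lemma scalar_prod_self_nonneg: "0 \<le> u \<bullet> (u :: real vec)"
  by (simp add: scalar_prod_def sum_nonneg)

lemma scalar_prod_diff_self:
  fixes u w :: "real vec"
  assumes "u \<in> carrier_vec n" "w \<in> carrier_vec n"
  shows "(u - w) \<bullet> (u - w) = u \<bullet> u - 2 * (u \<bullet> w) + w \<bullet> w"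
  using assms comm_scalar_prod[of w n u]
  by (simp add: minus_scalar_prod_distrib[where n=n] scalar_prod_minus_distrib[where n=n])

lemma scalar_prod_le_mean:
  fixes u w :: "real vec"
  assumes "u \<in> carrier_vec n" "w \<in> carrier_vec n"
  shows "2 * (u \<bullet> w) \<le> u \<bullet> u + w \<bullet> w"
  using scalar_prod_self_nonneg[of "u - w"] scalar_prod_diff_self[OF assms] by simp

lemma isometry_scalar_prod:
  fixes W :: "real mat"
  assumes W: "W \<in> carrier_mat n m" and orth: "W\<^sup>T * W = 1\<^sub>m m" and z: "z \<in> carrier_vec m"
  shows "(W *\<^sub>v z) \<bullet> (W *\<^sub>v z) = z \<bullet> z"
proof -
  have "(W *\<^sub>v z) \<bullet> (W *\<^sub>v z) = (W\<^sup>T *\<^sub>v (W *\<^sub>v z)) \<bullet> z"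
    using transpose_vec_mult_scalar[OF W z, of "W *\<^sub>v z"] W z by simp
  also have "W\<^sup>T *\<^sub>v (W *\<^sub>v z) = z"
    using W z orth by (simp flip: assoc_mult_mat_vec[of _ m n _ m])
  finally show ?thesis .
qed

text \<open>Subtracting from \<open>y\<close> its projection \<open>W *\<^sub>v (W\<^sup>T *\<^sub>v y)\<close> to the span of the columns of
  \<open>W\<close> leaves a vector whose squared length is the difference of the two sides.\<close>

lemma bessel_inequality:
  fixes W :: "real mat"
  assumes W: "W \<in> carrier_mat n m" and orth: "W\<^sup>T * W = 1\<^sub>m m" and y: "y \<in> carrier_vec n"
  shows "(W\<^sup>T *\<^sub>v y) \<bullet> (W\<^sup>T *\<^sub>v y) \<le> y \<bullet> y"
proof -
  define z where "z = W\<^sup>T *\<^sub>v y"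
  have z: "z \<in> carrier_vec m" and Wz: "W *\<^sub>v z \<in> carrier_vec n"
    using W y by (auto simp: z_def)
  have "0 \<le> (y - W *\<^sub>v z) \<bullet> (y - W *\<^sub>v z)"
    by (rule scalar_prod_self_nonneg)
  also have "\<dots> = y \<bullet> y - 2 * (z \<bullet> z) + z \<bullet> z"
    using scalar_prod_diff_self[OF y Wz] isometry_scalar_prod[OF W orth z]
      transpose_vec_mult_scalar[OF W z y] by (simp add: z_def)
  finally show ?thesis by (simp add: z_def)
qed

section \<open>The Frobenius inner product\<close>

definition frob_inner :: "real mat \<Rightarrow> real mat \<Rightarrow> real" where
  "frob_inner X Y = (\<Sum>i<dim_row X. \<Sum>j<dim_col X. X $$ (i, j) * Y $$ (i, j))"

lemma frobenius_norm_sq: "(frobenius_norm X)\<^sup>2 = frob_inner X X"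
  by (simp add: frobenius_norm_def frob_inner_def power2_eq_square sum_nonneg)

lemma frob_inner_commute:
  assumes "X \<in> carrier_mat n m" "Y \<in> carrier_mat n m"
  shows "frob_inner X Y = frob_inner Y X"
  using assms by (simp add: frob_inner_def mult.commute)

lemma frob_inner_diff_left:
  assumes "X \<in> carrier_mat n m" "Y \<in> carrier_mat n m"
  shows "frob_inner (X - Y) Z = frob_inner X Z - frob_inner Y Z"
  using assms by (simp add: frob_inner_def left_diff_distrib sum_subtractf)

lemma frob_inner_diff_right:
  assumes "X \<in> carrier_mat n m" "Y \<in> carrier_mat n m" "Z \<in> carrier_mat n m"
  shows "frob_inner Z (X - Y) = frob_inner Z X - frob_inner Z Y"
  using assms by (simp add: frob_inner_def right_diff_distrib sum_subtractf)

lemma frob_inner_diff_self: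
  assumes "X \<in> carrier_mat n m" "Y \<in> carrier_mat n m"
  shows "frob_inner (X - Y) (X - Y) = frob_inner X X - 2 * frob_inner X Y + frob_inner Y Y"
  using assms frob_inner_commute[OF assms] minus_carrier_mat[of Y n m X]
  by (simp add: frob_inner_diff_left[where n=n and m=m] frob_inner_diff_right[where n=n and m=m])

lemma frob_inner_transpose:
  assumes "X \<in> carrier_mat n m" "Y \<in> carrier_mat n m"
  shows "frob_inner X\<^sup>T Y\<^sup>T = frob_inner X Y"
  using assms by (simp add: frob_inner_def sum.swap[of _ "{..<n}" "{..<m}"])

text \<open>Multiplication by \<open>X\<close> and by its transpose are adjoint. This lemma and its mirror image for
  the right factor do the work of the cyclic invariance of the trace.\<close>

lemma frob_inner_mult_left:
  assumes X: "X \<in> carrier_mat n l" and Y: "Y \<in> carrier_mat l m" and Z: "Z \<in> carrier_mat n m"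
  shows "frob_inner (X * Y) Z = frob_inner Y (X\<^sup>T * Z)"
proof -
  have "frob_inner (X * Y) Z
      = (\<Sum>i<n. \<Sum>j<m. \<Sum>p<l. X $$ (i, p) * Y $$ (p, j) * Z $$ (i, j))"
    using X Y by (simp add: frob_inner_def scalar_prod_def atLeast0LessThan sum_distrib_right)
  also have "\<dots> = (\<Sum>i<n. \<Sum>p<l. \<Sum>j<m. X $$ (i, p) * Y $$ (p, j) * Z $$ (i, j))"
    by (intro sum.cong refl sum.swap)
  also have "\<dots> = (\<Sum>p<l. \<Sum>i<n. \<Sum>j<m. X $$ (i, p) * Y $$ (p, j) * Z $$ (i, j))"
    by (rule sum.swap)
  also have "\<dots> = (\<Sum>p<l. \<Sum>j<m. \<Sum>i<n. X $$ (i, p) * Y $$ (p, j) * Z $$ (i, j))"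
    by (intro sum.cong refl sum.swap)
  also have "\<dots> = frob_inner Y (X\<^sup>T * Z)"
    using X Y Z
    by (simp add: frob_inner_def scalar_prod_def atLeast0LessThan sum_distrib_left ac_simps)
  finally show ?thesis .
qed

lemma frob_inner_mult_right:
  assumes X: "X \<in> carrier_mat n l" and Y: "Y \<in> carrier_mat l m" and Z: "Z \<in> carrier_mat n m"
  shows "frob_inner (X * Y) Z = frob_inner X (Z * Y\<^sup>T)"
proof -
  have "frob_inner (X * Y) Z = frob_inner (Y\<^sup>T * X\<^sup>T) Z\<^sup>T"
    using assms by (simp add: frob_inner_transpose[of _ n m] flip: transpose_mult[OF X Y])
  also have "\<dots> = frob_inner X\<^sup>T (Y * Z\<^sup>T)"
    using assms by (subst frob_inner_mult_left[of _ m l _ n]) auto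
  also have "\<dots> = frob_inner X\<^sup>T (Z * Y\<^sup>T)\<^sup>T"
    using assms by (simp add: transpose_mult[of Z n m _ l])
  also have "\<dots> = frob_inner X (Z * Y\<^sup>T)"
    using assms by (intro frob_inner_transpose[of _ n l]) auto
  finally show ?thesis .
qed

lemma frob_inner_cauchy_schwarz:
  assumes "X \<in> carrier_mat n m" "Y \<in> carrier_mat n m"
  shows "frob_inner X Y \<le> frobenius_norm X * frobenius_norm Y"
proof -
  have "frob_inner X Y = (\<Sum>p\<in>{..<n}\<times>{..<m}. X $$ p * Y $$ p)"
    using assms by (simp add: frob_inner_def sum.cartesian_product case_prod_unfold)
  moreover have "frobenius_norm X = sqrt (\<Sum>p\<in>{..<n}\<times>{..<m}. (X $$ p)\<^sup>2)"
    using assms by (simp add: frobenius_norm_def sum.cartesian_product case_prod_unfold)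
  moreover have "frobenius_norm Y = sqrt (\<Sum>p\<in>{..<n}\<times>{..<m}. (Y $$ p)\<^sup>2)"
    using assms by (simp add: frobenius_norm_def sum.cartesian_product case_prod_unfold)
  ultimately show ?thesis
    using Cauchy_Schwarz_ineq_sum[of "\<lambda>p. X $$ p" "\<lambda>p. Y $$ p" "{..<n}\<times>{..<m}"]
    by (simp add: real_le_rsqrt flip: real_sqrt_mult)
qed

lemma frob_inner_isometry:
  assumes V: "V \<in> carrier_mat n k" and orth: "V\<^sup>T * V = 1\<^sub>m k"
    and X: "X \<in> carrier_mat k m" and Y: "Y \<in> carrier_mat k m"
  shows "frob_inner (V * X) (V * Y) = frob_inner X Y"
proof -
  have "V\<^sup>T * (V * Y) = Y"
    using assms by (simp flip: assoc_mult_mat[of _ k n _ k _ m])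
  then show ?thesis
    using assms by (simp add: frob_inner_mult_left[of V n k])
qed

lemma frob_inner_one_one: "frob_inner (1\<^sub>m k) (1\<^sub>m k) = real k"
  by (simp add: frob_inner_def if_distrib cong: if_cong)

lemma frob_inner_isometry_self:
  assumes V: "V \<in> carrier_mat n k" and orth: "V\<^sup>T * V = 1\<^sub>m k"
  shows "frob_inner V V = real k"
  using frob_inner_isometry[OF V orth, of "1\<^sub>m k" k "1\<^sub>m k"] V by (simp add: frob_inner_one_one)

text \<open>The inner product with the identity matrix is the trace.\<close>

lemma frob_inner_one_left: 
  assumes "S \<in> carrier_mat k k"
  shows "frob_inner (1\<^sub>m k) S = (\<Sum>i<k. S $$ (i, i))"
  using assms by (simp add: frob_inner_def if_distrib[of "\<lambda>c. c * _"] cong: if_cong)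

section \<open>Householder reflections\<close>

text \<open>For a unit vector \<open>u\<close> this is the reflection $1 - 2 u u^T$ in the hyperplane orthogonal to \<open>u\<close>.\<close>

definition reflection :: "nat \<Rightarrow> real vec \<Rightarrow> real mat" where
  "reflection k u = mat k k (\<lambda>(i, j). (if i = j then 1 else 0) - 2 * u $ i * u $ j)"

lemma reflection_carrier [simp]: "reflection k u \<in> carrier_mat k k"
  by (simp add: reflection_def)

lemma reflection_dim [simp]: "dim_row (reflection k u) = k" "dim_col (reflection k u) = k"
  by (simp_all add: reflection_def)

lemma transpose_reflection [simp]: "(reflection k u)\<^sup>T = reflection k u"
  by (rule eq_matI) (auto simp: reflection_def)

lemma reflection_mult_vec:
  assumes "u \<in> carrier_vec k" "x \<in> carrier_vec k"
  shows "reflection k u *\<^sub>v x = x - (2 * (u \<bullet> x)) \<cdot>\<^sub>v u"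
proof (rule eq_vecI)
  fix i assume "i < dim_vec (x - (2 * (u \<bullet> x)) \<cdot>\<^sub>v u)"
  then have i: "i < k" using assms by simp
  have "(reflection k u *\<^sub>v x) $ i = (\<Sum>j<k. ((if i = j then 1 else 0) - 2 * u $ i * u $ j) * x $ j)"
    using i assms by (simp add: reflection_def scalar_prod_def atLeast0LessThan)
  also have "\<dots> = (\<Sum>j<k. (if i = j then 1 else 0) * x $ j) - 2 * u $ i * (\<Sum>j<k. u $ j * x $ j)"
    by (simp only: left_diff_distrib sum_subtractf sum_distrib_left mult.assoc)
  also have "\<dots> = (x - (2 * (u \<bullet> x)) \<cdot>\<^sub>v u) $ i"
    using i assms by (simp add: scalar_prod_def atLeast0LessThan
        if_distrib[of "\<lambda>c. c * _"] cong: if_cong)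
  finally show "(reflection k u *\<^sub>v x) $ i = (x - (2 * (u \<bullet> x)) \<cdot>\<^sub>v u) $ i" .
qed (use assms in simp)

lemma reflection_involution:
  assumes u: "u \<in> carrier_vec k" and unit: "u \<bullet> u = 1"
  shows "reflection k u * reflection k u = 1\<^sub>m k"
proof -
  have *: "reflection k u *\<^sub>v (reflection k u *\<^sub>v x) = x" if "x \<in> carrier_vec k" for x
    using u that unit comm_scalar_prod[of u k x]
    by (intro eq_vecI)
       (auto simp: reflection_mult_vec[of _ k] scalar_prod_minus_distrib[where n=k] algebra_simps)
  show ?thesis
  proof (rule eq_matI)
    fix i j assume ij: "i < dim_row (1\<^sub>m k :: real mat)" "j < dim_col (1\<^sub>m k :: real mat)"
    have "(reflection k u * reflection k u) $$ (i, j) = col (reflection k u * reflection k u) j $ i"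
      using ij by simp
    also have "col (reflection k u * reflection k u) j
        = (reflection k u * reflection k u) *\<^sub>v unit_vec k j"
      using ij by (intro eq_vecI) auto
    also have "\<dots> = unit_vec k j"
      by (subst assoc_mult_mat_vec[of _ k k _ k]) (auto simp: *)
    finally show "(reflection k u * reflection k u) $$ (i, j) = 1\<^sub>m k $$ (i, j)"
      using ij by simp
  qed auto
qed

lemma reflection_orthogonal:
  assumes "u \<in> carrier_vec k" "u \<bullet> u = 1"
  shows "reflection k u \<in> orthogonal_group_mats k"
  using reflection_involution[OF assms] by (simp add: orthogonal_group_mats_def)

lemma orthogonal_group_mats_mult:
  assumes "R \<in> orthogonal_group_mats k" "T \<in> orthogonal_group_mats k"
  shows "R * T \<in> orthogonal_group_mats k"
proof -
  have R: "R \<in> carrier_mat k k" "R\<^sup>T * R = 1\<^sub>m k" "R * R\<^sup>T = 1\<^sub>m k"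
    and T: "T \<in> carrier_mat k k" "T\<^sup>T * T = 1\<^sub>m k" "T * T\<^sup>T = 1\<^sub>m k"
    using assms by (auto simp: orthogonal_group_mats_def)
  have "(R * T)\<^sup>T * (R * T) = T\<^sup>T * ((R\<^sup>T * R) * T)"
    using R(1) T(1) by (simp add: transpose_mult[of _ k k _ k] assoc_mult_mat[of _ k k _ k _ k])
  moreover have "(R * T) * (R * T)\<^sup>T = R * ((T * T\<^sup>T) * R\<^sup>T)"
    using R(1) T(1) by (simp add: transpose_mult[of _ k k _ k] assoc_mult_mat[of _ k k _ k _ k])
  ultimately show ?thesis
    using R T by (simp add: orthogonal_group_mats_def)
qed

lemma frob_inner_reflection:
  assumes u: "u \<in> carrier_vec k" and S: "S \<in> carrier_mat k k"
  shows "frob_inner (reflection k u) S = frob_inner (1\<^sub>m k) S - 2 * (u \<bullet> (S *\<^sub>v u))"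
proof -
  have "frob_inner (reflection k u) S
      = (\<Sum>i<k. \<Sum>j<k. 1\<^sub>m k $$ (i, j) * S $$ (i, j) - 2 * (u $ i * (S $$ (i, j) * u $ j)))"
    unfolding frob_inner_def
    by (intro sum.cong) (auto simp: reflection_def algebra_simps)
  also have "\<dots> = frob_inner (1\<^sub>m k) S - 2 * (u \<bullet> (S *\<^sub>v u))"
    using u S by (simp add: frob_inner_def scalar_prod_def sum_subtractf sum_distrib_left
        atLeast0LessThan mult.assoc)
  finally show ?thesis .
qed

lemma frob_inner_two_reflections:
  assumes u: "u \<in> carrier_vec k" and w: "w \<in> carrier_vec k" and S: "S \<in> carrier_mat k k"
  shows "frob_inner (reflection k u * reflection k w) S
    = frob_inner (1\<^sub>m k) S - 2 * (u \<bullet> (S *\<^sub>v u)) - 2 * (w \<bullet> (S *\<^sub>v w))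
      + 4 * (u \<bullet> w) * (u \<bullet> (S *\<^sub>v w))"
proof -
  have "frob_inner (reflection k u * reflection k w) S = frob_inner (reflection k w) (reflection k u * S)"
    using S frob_inner_mult_left[of "reflection k u" k k "reflection k w" k S] by simp
  also have "\<dots> = frob_inner (1\<^sub>m k) (reflection k u * S) - 2 * (w \<bullet> ((reflection k u * S) *\<^sub>v w))"
    using w S by (intro frob_inner_reflection) auto
  also have "frob_inner (1\<^sub>m k) (reflection k u * S) = frob_inner (reflection k u) S"
    using S frob_inner_mult_left[of "reflection k u" k k "1\<^sub>m k" k S] by simp
  also have "frob_inner (reflection k u) S = frob_inner (1\<^sub>m k) S - 2 * (u \<bullet> (S *\<^sub>v u))"
    by (rule frob_inner_reflection[OF u S])
  also have "w \<bullet> ((reflection k u * S) *\<^sub>v w) = w \<bullet> (S *\<^sub>v w) - 2 * (u \<bullet> w) * (u \<bullet> (S *\<^sub>v w))"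
  proof -
    have "(reflection k u * S) *\<^sub>v w = S *\<^sub>v w - (2 * (u \<bullet> (S *\<^sub>v w))) \<cdot>\<^sub>v u"
      using u w S by (simp add: assoc_mult_mat_vec[of _ k k _ k] reflection_mult_vec)
    then show ?thesis
      using u w S comm_scalar_prod[of w k u]
      by (simp add: scalar_prod_minus_distrib[where n=k])
  qed
  finally show ?thesis by (simp add: algebra_simps)
qed


section \<open>Matrices whose trace is maximal under the orthogonal group\<close>

lemma scalar_prod_self_eq_0:
  fixes u :: "real vec"
  assumes "u \<in> carrier_vec n" "u \<bullet> u = 0"
  shows "u = 0\<^sub>v n"
  using assms by (intro eq_vecI) (auto simp: scalar_prod_def sum_nonneg_eq_0_iff)

text \<open>Multiplying \<open>S\<close> by the reflection along a unit vector \<open>u\<close> lowers the trace by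
  \<open>2 * (u \<bullet> (S *\<^sub>v u))\<close>, which maximality forces to be nonnegative.\<close>

lemma trace_maximal_imp_psd:
  assumes S: "S \<in> carrier_mat k k"
    and max: "\<And>H. H \<in> orthogonal_group_mats k \<Longrightarrow> frob_inner H S \<le> frob_inner (1\<^sub>m k) S"
    and u: "u \<in> carrier_vec k"
  shows "0 \<le> u \<bullet> (S *\<^sub>v u)"
proof (cases "u \<bullet> u = 0")
  case True
  then have "u = 0\<^sub>v k" using u by (simp add: scalar_prod_self_eq_0)
  then show ?thesis using S by simp
next
  case False
  then have pos: "u \<bullet> u > 0" using scalar_prod_self_nonneg[of u] by simp
  define c where "c = 1 / sqrt (u \<bullet> u)"
  have c: "c * c * (u \<bullet> u) = 1" "c > 0"
    using pos by (auto simp: c_def)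
  have "(c \<cdot>\<^sub>v u) \<bullet> (c \<cdot>\<^sub>v u) = 1"
    using u c by (simp add: mult.assoc)
  then have "frob_inner (reflection k (c \<cdot>\<^sub>v u)) S \<le> frob_inner (1\<^sub>m k) S"
    using u by (intro max reflection_orthogonal) auto
  then have "0 \<le> (c \<cdot>\<^sub>v u) \<bullet> (S *\<^sub>v (c \<cdot>\<^sub>v u))"
    using u S by (simp add: frob_inner_reflection)
  then have "0 \<le> c * c * (u \<bullet> (S *\<^sub>v u))"
    using u S mult_mat_vec[OF S u, of c]
      smult_scalar_prod_distrib[of u k "S *\<^sub>v (c \<cdot>\<^sub>v u)" c]
      scalar_prod_smult_distrib[of u k "S *\<^sub>v u" c] by (simp add: mult.assoc)
  then show ?thesis
    using c(2) by (simp add: zero_le_mult_iff mult_le_0_iff)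
qed

text \<open>The product of the reflections along two unit vectors \<open>u\<close> and \<open>w\<close> is a rotation in their
  plane, so maximality gives
  \<open>2 * (u \<bullet> w) * (u \<bullet> (S *\<^sub>v w)) \<le> u \<bullet> (S *\<^sub>v u) + w \<bullet> (S *\<^sub>v w)\<close>. When \<open>w\<close> is close to
  \<open>u\<close>, the two sides agree up to a term of first order in the angle, which is a multiple of
  an antisymmetric difference of entries of \<open>S\<close>. It can have either sign, hence it vanishes.\<close>

lemma trace_maximal_imp_symmetric:
  assumes S: "S \<in> carrier_mat k k"
    and max: "\<And>H. H \<in> orthogonal_group_mats k \<Longrightarrow> frob_inner H S \<le> frob_inner (1\<^sub>m k) S"
  shows "S\<^sup>T = S"
proof -
  have entry_sym: "S $$ (i, j) = S $$ (j, i)" if i: "i < k" and j: "j < k" and ij: "i \<noteq> j" for i j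
  proof -
    define d where "d = S $$ (i, j) - S $$ (j, i)"
    define e where "e = S $$ (i, i) + S $$ (j, j)"
    have diag: "0 \<le> S $$ (l, l)" if "l < k" for l
      using trace_maximal_imp_psd[OF S max, of "unit_vec k l"] that S by simp
    have e: "0 \<le> e"
      using diag i j by (simp add: e_def)
    \<comment> \<open>Compare \<open>u = e\<^sub>i\<close> with the normalization of \<open>e\<^sub>i + t e\<^sub>j\<close>; the terms of order 0 in
      \<open>t\<close> cancel.\<close>
    have *: "t * d \<le> t\<^sup>2 * e" for t
    proof -
      define c where "c = 1 / sqrt (1 + t\<^sup>2)"
      have pos: "1 + t\<^sup>2 > 0" by (simp add: add_pos_nonneg)
      have c: "c\<^sup>2 * (1 + t\<^sup>2) = 1" 
        using pos by (simp add: c_def power_divide)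
      define u where "u = (unit_vec k i :: real vec)"
      define w where "w = c \<cdot>\<^sub>v (unit_vec k i + t \<cdot>\<^sub>v unit_vec k j)"
      have u: "u \<in> carrier_vec k" and w: "w \<in> carrier_vec k"
        by (auto simp: u_def w_def)
      have uu: "u \<bullet> u = 1" using i by (simp add: u_def)
      have dist: "z \<bullet> w = c * (z $ i + t * z $ j)" if "z \<in> carrier_vec k" for z
        using that i j
        by (simp add: w_def scalar_prod_smult_distrib[where n=k] scalar_prod_add_distrib[where n=k])
      have ww: "w \<bullet> w = 1"
        using c i j ij by (subst dist[OF w]) (simp add: w_def power2_eq_square algebra_simps)
      have uw: "u \<bullet> w = c"
        using i j ij by (subst dist[OF u]) (simp add: u_def)
      have Sw: "(S *\<^sub>v w) $ l = c * (S $$ (l, i) + t * S $$ (l, j))" if "l < k" for l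
        using that S i j by (simp add: dist)
      have uSw: "u \<bullet> (S *\<^sub>v w) = c * (S $$ (i, i) + t * S $$ (i, j))"
        using S i w Sw[OF i] scalar_prod_left_unit[of "S *\<^sub>v w" k i] by (simp add: u_def)
      have uSu: "u \<bullet> (S *\<^sub>v u) = S $$ (i, i)"
        using S i scalar_prod_left_unit[of "S *\<^sub>v u" k i] by (simp add: u_def)
      have "w \<bullet> (S *\<^sub>v w) = (S *\<^sub>v w) \<bullet> w"
        using S w by (intro comm_scalar_prod[where n=k]) auto
      also have "\<dots> = c\<^sup>2 * (S $$ (i, i) + t * S $$ (i, j) + t * (S $$ (j, i) + t * S $$ (j, j)))"
        using S w Sw[OF i] Sw[OF j]
        by (subst dist) (auto simp: power2_eq_square algebra_simps)
      finally have wSw: "w \<bullet> (S *\<^sub>v w) = \<dots>" .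
      have "frob_inner (reflection k u * reflection k w) S \<le> frob_inner (1\<^sub>m k) S"
        using u w uu ww by (intro max orthogonal_group_mats_mult reflection_orthogonal)
      then have "2 * (u \<bullet> w) * (u \<bullet> (S *\<^sub>v w)) \<le> u \<bullet> (S *\<^sub>v u) + w \<bullet> (S *\<^sub>v w)"
        by (simp add: frob_inner_two_reflections[OF u w S])
      then have ineq: "2 * c\<^sup>2 * (S $$ (i, i) + t * S $$ (i, j)) \<le> c\<^sup>2 * (1 + t\<^sup>2) * S $$ (i, i)
          + c\<^sup>2 * (S $$ (i, i) + t * S $$ (i, j) + t * (S $$ (j, i) + t * S $$ (j, j)))"
        unfolding uw uSw uSu wSw c by (simp add: power2_eq_square mult.assoc)
      then have "c\<^sup>2 * (t * d) \<le> c\<^sup>2 * (t\<^sup>2 * e)"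
        by (simp add: d_def e_def algebra_simps power2_eq_square)
      moreover have "c\<^sup>2 > 0" using pos by (simp add: c_def)
      ultimately show ?thesis by simp
    qed
    \<comment> \<open>A small \<open>t\<close> with the sign of \<open>d\<close> makes the linear term win, unless \<open>d = 0\<close>; the
      summand 1 only avoids a division by zero.\<close>
    define t where "t = d / (e + 1)"
    have d: "d = t * (e + 1)" using e by (simp add: t_def)
    have "t\<^sup>2 \<le> 0"
      using *[of t] by (simp add: d power2_eq_square algebra_simps)
    then have "d = 0" by (simp add: d)
    then show ?thesis by (simp add: d_def)
  qed
  show ?thesis
  proof (rule eq_matI)
    fix i j assume "i < dim_row S" "j < dim_col S"
    then show "S\<^sup>T $$ (i, j) = S $$ (i, j)"
      using S entry_sym[of i j] by (cases "i = j") auto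
  qed (use S in auto)
qed

text \<open>In terms of eigenvalues this is $\mu^2 \le \mu$ for $0 \le \mu \le 1$. Without
  diagonalization, positivity of the quadratic form of \<open>S\<close> at \<open>u - S *\<^sub>v u\<close> gives
  \<open>(S *\<^sub>v u) \<bullet> (S *\<^sub>v u) \<le> u \<bullet> (S *\<^sub>v u)\<close>, and the sum over the standard basis gives the claim.\<close>

lemma trace_ge_frobenius_of_psd_contraction:
  assumes S: "S \<in> carrier_mat k k" and sym: "S\<^sup>T = S"
    and psd: "\<And>u. u \<in> carrier_vec k \<Longrightarrow> 0 \<le> u \<bullet> (S *\<^sub>v u)"
    and contr: "\<And>u. u \<in> carrier_vec k \<Longrightarrow> (S *\<^sub>v u) \<bullet> (S *\<^sub>v u) \<le> u \<bullet> u"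
  shows "frob_inner S S \<le> frob_inner (1\<^sub>m k) S"
proof -
  have le: "(S *\<^sub>v u) \<bullet> (S *\<^sub>v u) \<le> u \<bullet> (S *\<^sub>v u)" if u: "u \<in> carrier_vec k" for u
  proof -
    define w where "w = S *\<^sub>v u"
    have w: "w \<in> carrier_vec k" and Sw: "S *\<^sub>v w \<in> carrier_vec k"
      using S u by (auto simp: w_def)
    have adj: "u \<bullet> (S *\<^sub>v w) = w \<bullet> w"
      using transpose_vec_mult_scalar[OF S w u] sym by (simp add: w_def)
    have "0 \<le> (u - w) \<bullet> (S *\<^sub>v (u - w))"
      using u w by (intro psd) auto
    also have "S *\<^sub>v (u - w) = w - S *\<^sub>v w"
      using mult_minus_distrib_mat_vec[OF S u w] by (simp add: w_def)
    also have "(u - w) \<bullet> (w - S *\<^sub>v w) = u \<bullet> w - 2 * (w \<bullet> w) + w \<bullet> (S *\<^sub>v w)"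
      using u w Sw adj
      by (simp add: minus_scalar_prod_distrib[where n=k] scalar_prod_minus_distrib[where n=k])
    finally have "2 * (w \<bullet> w) \<le> u \<bullet> w + w \<bullet> (S *\<^sub>v w)" by simp
    moreover have "w \<bullet> (S *\<^sub>v w) \<le> w \<bullet> w"
      using scalar_prod_le_mean[OF w Sw] contr[OF w] by simp
    ultimately show ?thesis by (simp add: w_def)
  qed
  have "frob_inner S S = (\<Sum>j<k. \<Sum>i<k. S $$ (i, j) * S $$ (i, j))"
    using S unfolding frob_inner_def by (subst sum.swap) simp
  also have "\<dots> \<le> (\<Sum>j<k. S $$ (j, j))"
  proof (rule sum_mono)
    fix j assume "j \<in> {..<k}"
    then have j: "j < k" by simp
    have "S *\<^sub>v unit_vec k j = col S j"
      using S j by (intro eq_vecI) auto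
    then have "col S j \<bullet> col S j \<le> S $$ (j, j)"
      using le[of "unit_vec k j"] S j scalar_prod_left_unit[of "col S j" k j] by simp
    then show "(\<Sum>i<k. S $$ (i, j) * S $$ (i, j)) \<le> S $$ (j, j)"
      using S j by (simp add: scalar_prod_def atLeast0LessThan)
  qed
  also have "\<dots> = frob_inner (1\<^sub>m k) S"
    by (simp add: frob_inner_one_left[OF S])
  finally show ?thesis .
qed

section \<open>Optimal alignment of two orthonormal frames\<close>

text \<open>Up to constants, minus twice the trace of \<open>R\<^sup>T * (V\<^sup>T * V')\<close> is the squared distance from
  \<open>V'\<close> to \<open>V * R\<close>. A minimizer \<open>Q\<close> therefore maximizes this trace, and the identity matrix maximizes
  the trace after \<open>Q\<close> has been absorbed into \<open>S\<close>. The preceding section then bounds the trace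
  of \<open>S\<close> from below.\<close>

lemma optimal_alignment_bound:
  assumes V: "V \<in> carrier_mat n k" "V\<^sup>T * V = 1\<^sub>m k"
    and V': "V' \<in> carrier_mat n k" "V'\<^sup>T * V' = 1\<^sub>m k"
    and opt: "is_optimal_alignment k V V' Q"
  shows "(frobenius_norm (V' - V * Q))\<^sup>2 \<le> 2 * (real k - frob_inner (V\<^sup>T * V') (V\<^sup>T * V'))"
proof -
  define M where "M = V\<^sup>T * V'"
  have M: "M \<in> carrier_mat k k"
    using V V' by (auto simp: M_def)
  have Qo: "Q \<in> orthogonal_group_mats k"
    and min: "\<And>R. R \<in> orthogonal_group_mats k
      \<Longrightarrow> frobenius_norm (V' - V * Q) \<le> frobenius_norm (V' - V * R)"
    using opt by (force simp: is_optimal_alignment_def is_arg_min_linorder)+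
  have Q: "Q \<in> carrier_mat k k" "Q\<^sup>T * Q = 1\<^sub>m k" "Q * Q\<^sup>T = 1\<^sub>m k"
    using Qo by (auto simp: orthogonal_group_mats_def)
  have dist: "(frobenius_norm (V' - V * R))\<^sup>2 = 2 * real k - 2 * frob_inner R M"
    if "R \<in> orthogonal_group_mats k" for R
  proof -
    have R: "R \<in> carrier_mat k k" "R\<^sup>T * R = 1\<^sub>m k"
      using that by (auto simp: orthogonal_group_mats_def)
    have VR: "V * R \<in> carrier_mat n k" using V R by simp
    have "frob_inner (V * R) (V * R) = real k"
      using frob_inner_isometry[OF V R(1) R(1)] frob_inner_isometry_self[OF R] by simp
    moreover have "frob_inner V' (V * R) = frob_inner R M"
      using frob_inner_commute[OF V'(1) VR] frob_inner_mult_left[OF V(1) R(1) V'(1)]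
      by (simp add: M_def)
    ultimately show ?thesis
      using frob_inner_isometry_self[OF V'] frob_inner_diff_self[OF V'(1) VR]
      by (simp add: frobenius_norm_sq)
  qed
  define S where "S = Q\<^sup>T * M"
  have S: "S \<in> carrier_mat k k"
    using Q M by (auto simp: S_def)
  have QT: "Q\<^sup>T \<in> carrier_mat k k" "(Q\<^sup>T)\<^sup>T * Q\<^sup>T = 1\<^sub>m k"
    using Q by auto
  have max: "frob_inner H S \<le> frob_inner (1\<^sub>m k) S" if H: "H \<in> orthogonal_group_mats k" for H
  proof -
    have Hc: "H \<in> carrier_mat k k" using H by (auto simp: orthogonal_group_mats_def)
    have QH: "Q * H \<in> orthogonal_group_mats k"
      using Qo H by (rule orthogonal_group_mats_mult)
    have "(frobenius_norm (V' - V * Q))\<^sup>2 \<le> (frobenius_norm (V' - V * (Q * H)))\<^sup>2"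
      using min[OF QH] by (intro power_mono) (auto simp: frobenius_norm_def sum_nonneg)
    then have "frob_inner (Q * H) M \<le> frob_inner (Q * 1\<^sub>m k) M"
      using dist[OF Qo] dist[OF QH] Q by simp
    then show ?thesis
      using frob_inner_mult_left[OF Q(1) Hc M] frob_inner_mult_left[OF Q(1) one_carrier_mat M]
      by (simp add: S_def)
  qed
  have contr: "(S *\<^sub>v u) \<bullet> (S *\<^sub>v u) \<le> u \<bullet> u" if u: "u \<in> carrier_vec k" for u
  proof -
    have Vu: "V' *\<^sub>v u \<in> carrier_vec n" and Mu: "V\<^sup>T *\<^sub>v (V' *\<^sub>v u) \<in> carrier_vec k"
      using V V' u by auto
    have "S *\<^sub>v u = Q\<^sup>T *\<^sub>v (V\<^sup>T *\<^sub>v (V' *\<^sub>v u))"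
      using Q V V' M u
      by (simp add: S_def M_def assoc_mult_mat_vec[of _ k k _ k] assoc_mult_mat_vec[of _ k n _ k])
    then have "(S *\<^sub>v u) \<bullet> (S *\<^sub>v u) \<le> (V\<^sup>T *\<^sub>v (V' *\<^sub>v u)) \<bullet> (V\<^sup>T *\<^sub>v (V' *\<^sub>v u))"
      using bessel_inequality[OF Q(1,2) Mu] by simp
    also have "\<dots> \<le> (V' *\<^sub>v u) \<bullet> (V' *\<^sub>v u)"
      by (rule bessel_inequality[OF V Vu])
    also have "\<dots> = u \<bullet> u"
      by (rule isometry_scalar_prod[OF V' u])
    finally show ?thesis .
  qed
  have "frob_inner M M = frob_inner S S"
    using frob_inner_isometry[OF QT M M] by (simp add: S_def)
  also have "\<dots> \<le> frob_inner (1\<^sub>m k) S"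
    using S trace_maximal_imp_symmetric[OF S max] trace_maximal_imp_psd[OF S max] contr
    by (rule trace_ge_frobenius_of_psd_contraction)
  also have "\<dots> = frob_inner Q M"
    using frob_inner_mult_left[OF Q(1) one_carrier_mat M] Q by (simp add: S_def)
  finally show ?thesis
    using dist[OF Qo] by (simp add: M_def)
qed

text \<open>Each of the two projections has squared norm \<open>k\<close>, and their inner product is the squared
  norm of \<open>V\<^sup>T * V'\<close>.\<close>

lemma projection_distance:
  assumes V: "V \<in> carrier_mat n k" "V\<^sup>T * V = 1\<^sub>m k"
    and V': "V' \<in> carrier_mat n k" "V'\<^sup>T * V' = 1\<^sub>m k"
  shows "(frobenius_norm (V * V\<^sup>T - V' * V'\<^sup>T))\<^sup>2
    = 2 * (real k - frob_inner (V\<^sup>T * V') (V\<^sup>T * V'))"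
proof -
  have proj: "frob_inner (X * X\<^sup>T) (X * X\<^sup>T) = real k"
    if "X \<in> carrier_mat n k" "X\<^sup>T * X = 1\<^sub>m k" for X :: "real mat"
  proof -
    have XT: "X\<^sup>T \<in> carrier_mat k n" using that by simp
    show ?thesis
      unfolding frob_inner_isometry[OF that XT XT] frob_inner_transpose[OF that(1) that(1)]
      by (rule frob_inner_isometry_self[OF that])
  qed
  have "frob_inner (V * V\<^sup>T) (V' * V'\<^sup>T) = frob_inner V\<^sup>T (V\<^sup>T * (V' * V'\<^sup>T))"
    using V V' by (intro frob_inner_mult_left[where n=n]) auto
  also have "V\<^sup>T * (V' * V'\<^sup>T) = (V\<^sup>T * V') * V'\<^sup>T"
    using V V' by (intro assoc_mult_mat[symmetric]) auto
  also have "frob_inner V\<^sup>T \<dots> = frob_inner (V\<^sup>T * V' * V'\<^sup>T) V\<^sup>T"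
    using V V' by (intro frob_inner_commute[where n=k and m=n]) auto
  also have "\<dots> = frob_inner (V\<^sup>T * V') (V\<^sup>T * V')"
    using V V' frob_inner_mult_right[of "V\<^sup>T * V'" k k "V'\<^sup>T" n "V\<^sup>T"] by simp
  finally have "frob_inner (V * V\<^sup>T) (V' * V'\<^sup>T) = frob_inner (V\<^sup>T * V') (V\<^sup>T * V')" .
  then show ?thesis
    using V V' proj[OF V] proj[OF V'] frob_inner_diff_self[of "V * V\<^sup>T" n n "V' * V'\<^sup>T"]
    by (simp add: frobenius_norm_sq)
qed

section \<open>Ordered eigensystems\<close>

lemma ordered_eigensystemD:
  assumes "ordered_eigensystem A lam v" "A \<in> carrier_mat N N"
  shows "j < N \<Longrightarrow> v j \<in> carrier_vec N"
    and "j < N \<Longrightarrow> A *\<^sub>v v j = lam j \<cdot>\<^sub>v v j"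
    and "i < N \<Longrightarrow> j < N \<Longrightarrow> v i \<bullet> v j = (if i = j then 1 else 0)"
    and "i \<le> j \<Longrightarrow> j < N \<Longrightarrow> lam j \<le> lam i"
  using assms by (auto simp: ordered_eigensystem_def eigenvector_def)

lemma top_eigenvectors_carrier [simp]: "top_eigenvectors N k v \<in> carrier_mat N k"
  using mat_of_cols_carrier(1)[of N "map v [0..<k]"] by (simp add: top_eigenvectors_def)

lemma col_top_eigenvectors:
  assumes "v j \<in> carrier_vec N" "j < k"
  shows "col (top_eigenvectors N k v) j = v j"
  using assms by (simp add: top_eigenvectors_def)

lemma top_eigenvectors_orthonormal:
  assumes eig: "ordered_eigensystem A lam v" and A: "A \<in> carrier_mat N N" and "k \<le> N"
  shows "(top_eigenvectors N k v)\<^sup>T * top_eigenvectors N k v = 1\<^sub>m k"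
proof (rule eq_matI)
  note dims = carrier_matD[OF top_eigenvectors_carrier[of N k v]]
  fix i j assume "i < dim_row (1\<^sub>m k :: real mat)" "j < dim_col (1\<^sub>m k :: real mat)"
  then show "((top_eigenvectors N k v)\<^sup>T * top_eigenvectors N k v) $$ (i, j) = 1\<^sub>m k $$ (i, j)"
    using ordered_eigensystemD[OF eig A] \<open>k \<le> N\<close>
    by (simp add: dims col_top_eigenvectors)
qed (use carrier_matD[OF top_eigenvectors_carrier[of N k v]] in simp_all)

lemma spectral_decomposition:
  assumes eig: "ordered_eigensystem A lam v" and A: "A \<in> carrier_mat N N"
  defines "U \<equiv> top_eigenvectors N N v"
  shows "U * U\<^sup>T = 1\<^sub>m N" and "A = U * mat_diag N lam * U\<^sup>T"
proof -
  have U: "U \<in> carrier_mat N N" by (simp add: U_def)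
  have orth: "U\<^sup>T * U = 1\<^sub>m N"
    unfolding U_def by (rule top_eigenvectors_orthonormal[OF eig A]) simp
  then show UUT: "U * U\<^sup>T = 1\<^sub>m N"
    using U by (intro mat_mult_left_right_inverse[of "U\<^sup>T" N]) auto
  have AU: "A * U = U * mat_diag N lam"
  proof (rule eq_matI)
    fix i j assume "i < dim_row (U * mat_diag N lam)" "j < dim_col (U * mat_diag N lam)"
    then have ij: "i < N" "j < N" using U by (auto simp: mat_diag_def)
    have col: "col U j = v j"
      using ij ordered_eigensystemD(1)[OF eig A] by (simp add: U_def col_top_eigenvectors)
    have "(A * U) $$ (i, j) = (A *\<^sub>v col U j) $ i"
      using ij A U by simp
    also have "\<dots> = lam j * col U j $ i"
      unfolding col using ij ordered_eigensystemD(1,2)[OF eig A ij(2)] by simp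
    also have "\<dots> = (U * mat_diag N lam) $$ (i, j)"
      using ij U by (simp add: mat_diag_mult_right[OF U])
    finally show "(A * U) $$ (i, j) = (U * mat_diag N lam) $$ (i, j)" .
  qed (use A U in \<open>auto simp: mat_diag_def\<close>)
  have "A = A * (U * U\<^sup>T)" using A UUT by simp
  also have "\<dots> = U * mat_diag N lam * U\<^sup>T"
    using A U by (simp flip: AU)
  finally show "A = U * mat_diag N lam * U\<^sup>T" .
qed

text \<open>For \<open>W\<close> with orthonormal columns, the inner sum on the right is the squared length of the
  projection of \<open>v i\<close> to the column space of \<open>W\<close>. The left side is thus a weighted sum
  of the eigenvalues of \<open>A\<close>.\<close>

lemma frob_inner_spectral:
  assumes eig: "ordered_eigensystem A lam v" and A: "A \<in> carrier_mat N N"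
    and W: "W \<in> carrier_mat N m"
  shows "frob_inner A (W * W\<^sup>T) = (\<Sum>i<N. lam i * (\<Sum>j<m. (v i \<bullet> col W j)\<^sup>2))"
proof -
  define U where "U = top_eigenvectors N N v"
  define G where "G = U\<^sup>T * W"
  have U: "U \<in> carrier_mat N N" by (simp add: U_def)
  have G: "G \<in> carrier_mat N m" using U W by (auto simp: G_def)
  have L: "mat_diag N lam \<in> carrier_mat N N" by simp
  have AW: "A * W = U * (mat_diag N lam * G)"
  proof -
    have "A * W = (U * mat_diag N lam * U\<^sup>T) * W"
      using spectral_decomposition(2)[OF eig A] by (simp flip: U_def)
    also have "\<dots> = (U * mat_diag N lam) * G"
      unfolding G_def using U W L by (intro assoc_mult_mat[of _ N N _ N _ m]) auto
    also have "\<dots> = U * (mat_diag N lam * G)"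
      by (rule assoc_mult_mat[OF U L G])
    finally show ?thesis .
  qed
  have "frob_inner A (W * W\<^sup>T) = frob_inner (A * W) W"
    using A W by (simp add: frob_inner_mult_right[of A N N W m W])
  also have "\<dots> = frob_inner (mat_diag N lam * G) G"
    unfolding AW using U W G L by (subst frob_inner_mult_left[of _ N N _ m])
      (auto simp: G_def intro!: mult_carrier_mat[OF L])
  also have "\<dots> = (\<Sum>i<N. lam i * (\<Sum>j<m. (G $$ (i, j))\<^sup>2))"
    using G by (simp add: frob_inner_def mat_diag_mult_left[OF G] sum_distrib_left
        power2_eq_square mult.assoc)
  also have "\<dots> = (\<Sum>i<N. lam i * (\<Sum>j<m. (v i \<bullet> col W j)\<^sup>2))"
  proof -
    have "G $$ (i, j) = v i \<bullet> col W j" if "i < N" "j < m" for i j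
      using that U W ordered_eigensystemD(1)[OF eig A, of i] col_top_eigenvectors[of v i N N]
      by (simp add: G_def flip: U_def)
    then show ?thesis by simp
  qed
  finally show ?thesis .
qed

section \<open>Perturbation of the top eigenspace\<close>

text \<open>A quantitative form of the maximum principle of Ky Fan. The weights \<open>a i\<close> of the eigenvalues
  in \<open>frob_inner A (W * W\<^sup>T)\<close> lie between 0 and 1 and sum to \<open>k\<close>, whereas for \<open>V\<close> the first \<open>k\<close>
  weights are 1. Passing from \<open>V\<close> to \<open>W\<close> moves the total weight
  \<open>k - frob_inner (V\<^sup>T * W) (V\<^sup>T * W)\<close> from eigenvalues that are at least \<open>lam (k - 1)\<close> to
  eigenvalues that are at most \<open>lam k\<close>.\<close>

lemma ky_fan_gap:
  assumes eig: "ordered_eigensystem A lam v" and A: "A \<in> carrier_mat N N"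
    and k: "1 \<le> k" "k < N"
    and W: "W \<in> carrier_mat N k" "W\<^sup>T * W = 1\<^sub>m k"
  defines "V \<equiv> top_eigenvectors N k v"
  shows "(lam (k - 1) - lam k) * (real k - frob_inner (V\<^sup>T * W) (V\<^sup>T * W))
    \<le> frob_inner A (V * V\<^sup>T) - frob_inner A (W * W\<^sup>T)"
    and "frob_inner (V\<^sup>T * W) (V\<^sup>T * W) \<le> real k"
proof -
  note eigD = ordered_eigensystemD[OF eig A]
  have V: "V \<in> carrier_mat N k" by (simp add: V_def)
  define a where "a i = (\<Sum>j<k. (v i \<bullet> col W j)\<^sup>2)" for i
  have a0: "0 \<le> a i" for i by (simp add: a_def sum_nonneg)
  have a1: "a i \<le> 1" if i: "i < N" for i
  proof -
    have "a i = (W\<^sup>T *\<^sub>v v i) \<bullet> (W\<^sup>T *\<^sub>v v i)"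
      using W eigD(1)[OF i]
      by (simp add: a_def scalar_prod_def[of "W\<^sup>T *\<^sub>v v i"] atLeast0LessThan power2_eq_square
          comm_scalar_prod[of "v i" N])
    also have "\<dots> \<le> v i \<bullet> v i"
      by (rule bessel_inequality[OF W eigD(1)[OF i]])
    finally show ?thesis using eigD(3)[OF i i] by simp
  qed
  define s where "s = frob_inner (V\<^sup>T * W) (V\<^sup>T * W)"
  have s: "s = (\<Sum>i<k. a i)"
  proof -
    have "(V\<^sup>T * W) $$ (i, j) = v i \<bullet> col W j" if "i < k" "j < k" for i j
      using that k V W eigD(1)[of i] col_top_eigenvectors[of v i N k] by (simp flip: V_def)
    then show ?thesis
      using V W by (simp add: s_def a_def frob_inner_def power2_eq_square)
  qed
  have total: "(\<Sum>i<N. a i) = real k"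
  proof -
    define U where "U = top_eigenvectors N N v"
    have U: "U \<in> carrier_mat N N" by (simp add: U_def)
    have UT: "U\<^sup>T \<in> carrier_mat N N" "(U\<^sup>T)\<^sup>T * U\<^sup>T = 1\<^sub>m N"
      using U spectral_decomposition(1)[OF eig A] by (auto simp flip: U_def)
    have "(U\<^sup>T * W) $$ (i, j) = v i \<bullet> col W j" if "i < N" "j < k" for i j
      using that U W eigD(1)[of i] col_top_eigenvectors[of v i N N] by (simp flip: U_def)
    then have "(\<Sum>i<N. a i) = frob_inner (U\<^sup>T * W) (U\<^sup>T * W)"
      using U W by (simp add: a_def frob_inner_def power2_eq_square)
    also have "\<dots> = real k"
      using frob_inner_isometry[OF UT W(1) W(1)] frob_inner_isometry_self[OF W] by simp
    finally show ?thesis .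
  qed
  have split: "(\<Sum>i<N. f i) = (\<Sum>i<k. f i) + (\<Sum>i=k..<N. f i)" for f :: "nat \<Rightarrow> real"
    using k sum.atLeastLessThan_concat[of 0 k N f] by (simp add: atLeast0LessThan)
  have tail: "(\<Sum>i=k..<N. a i) = real k - s"
    using total s split[of a] by simp
  show "frob_inner (V\<^sup>T * W) (V\<^sup>T * W) \<le> real k"
    using tail sum_nonneg[of "{k..<N}" a] a0 by (simp add: s_def)
  have AV: "frob_inner A (V * V\<^sup>T) = (\<Sum>i<k. lam i)"
  proof -
    have "(\<Sum>j<k. (v i \<bullet> col V j)\<^sup>2) = (if i < k then 1 else 0)" if i: "i < N" for i
    proof -
      have "(\<Sum>j<k. (v i \<bullet> col V j)\<^sup>2) = (\<Sum>j<k. if i = j then 1 else 0)"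
        using i k eigD(1,3) by (intro sum.cong) (auto simp: V_def col_top_eigenvectors)
      then show ?thesis by simp
    qed
    then show ?thesis
      using k by (simp add: frob_inner_spectral[OF eig A V] split)
  qed
  have AW: "frob_inner A (W * W\<^sup>T) = (\<Sum>i<k. lam i * a i) + (\<Sum>i=k..<N. lam i * a i)"
    by (simp add: frob_inner_spectral[OF eig A W(1)] split flip: a_def)
  have "(\<Sum>i<k. lam (k - 1) * (1 - a i)) \<le> (\<Sum>i<k. lam i * (1 - a i))"
    using k a1 eigD(4)[of _ "k - 1"] by (intro sum_mono mult_right_mono) auto
  moreover have "(\<Sum>i<k. lam (k - 1) * (1 - a i)) = lam (k - 1) * (real k - s)"
    by (simp add: s sum_subtractf flip: sum_distrib_left)
  moreover have "(\<Sum>i<k. lam i * (1 - a i)) = (\<Sum>i<k. lam i) - (\<Sum>i<k. lam i * a i)"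
    by (simp add: right_diff_distrib sum_subtractf)
  moreover have "(\<Sum>i=k..<N. lam i * a i) \<le> (\<Sum>i=k..<N. lam k * a i)"
    using a0 eigD(4)[of k] by (intro sum_mono mult_right_mono) auto
  moreover have "(\<Sum>i=k..<N. lam k * a i) = lam k * (real k - s)"
    by (simp add: tail flip: sum_distrib_left)
  ultimately show "(lam (k - 1) - lam k) * (real k - frob_inner (V\<^sup>T * W) (V\<^sup>T * W))
    \<le> frob_inner A (V * V\<^sup>T) - frob_inner A (W * W\<^sup>T)"
    unfolding AV AW s_def[symmetric] by (simp add: left_diff_distrib)
qed

text \<open>A variant of the Davis-Kahan theorem with a gap in the spectrum of \<open>A\<close> alone. The gap gives a
  lower bound for \<open>frob_inner (A - A') (P - P')\<close> that is quadratic in the norm of \<open>P - P'\<close>, while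
  Cauchy-Schwarz gives an upper bound that is linear in it.\<close>

lemma davis_kahan_one_gap:
  assumes eig: "ordered_eigensystem A lam v" and A: "A \<in> carrier_mat N N"
    and eig': "ordered_eigensystem A' lam' v'" and A': "A' \<in> carrier_mat N N"
    and k: "1 \<le> k" "k < N"
    and gap: "\<alpha> > 0" "lam (k - 1) - lam k \<ge> \<alpha>"
  defines "V \<equiv> top_eigenvectors N k v" and "V' \<equiv> top_eigenvectors N k v'"
  shows "frobenius_norm (V * V\<^sup>T - V' * V'\<^sup>T) \<le> 2 / \<alpha> * frobenius_norm (A - A')"
proof -
  have V: "V \<in> carrier_mat N k" "V\<^sup>T * V = 1\<^sub>m k"
    using top_eigenvectors_orthonormal[OF eig A] k by (auto simp: V_def)
  have V': "V' \<in> carrier_mat N k" "V'\<^sup>T * V' = 1\<^sub>m k"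
    using top_eigenvectors_orthonormal[OF eig' A'] k by (auto simp: V'_def)
  define P where "P = V * V\<^sup>T"
  define P' where "P' = V' * V'\<^sup>T"
  have P: "P \<in> carrier_mat N N" "P' \<in> carrier_mat N N"
    using V V' by (auto simp: P_def P'_def)
  define s where "s = real k - frob_inner (V\<^sup>T * V') (V\<^sup>T * V')"
  define p where "p = frobenius_norm (P - P')"
  have p0: "0 \<le> p" by (simp add: p_def frobenius_norm_def sum_nonneg)
  have s0: "0 \<le> s"
    using ky_fan_gap(2)[OF eig A k V'] by (simp add: s_def V_def)
  have p2: "p\<^sup>2 = 2 * s"
    using projection_distance[OF V V'] by (simp add: p_def P_def P'_def s_def)
  have "\<alpha> * s \<le> (lam (k - 1) - lam k) * s"
    using gap s0 by (intro mult_right_mono)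
  also have "\<dots> \<le> frob_inner A P - frob_inner A P'"
    using ky_fan_gap(1)[OF eig A k V'] by (simp add: s_def P_def P'_def V_def)
  finally have 1: "\<alpha> * s \<le> frob_inner A P - frob_inner A P'" .
  have "0 \<le> (lam' (k - 1) - lam' k) * (real k - frob_inner (V'\<^sup>T * V) (V'\<^sup>T * V))"
    using ordered_eigensystemD(4)[OF eig' A', of "k - 1" k] k ky_fan_gap(2)[OF eig' A' k V]
    by (simp add: V'_def)
  also have "\<dots> \<le> frob_inner A' P' - frob_inner A' P"
    using ky_fan_gap(1)[OF eig' A' k V] by (simp add: P_def P'_def V'_def)
  finally have "\<alpha> * s \<le> frob_inner A P - frob_inner A P' - (frob_inner A' P - frob_inner A' P')"
    using 1 by simp
  also have "\<dots> = frob_inner (A - A') (P - P')"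
    using A A' P minus_carrier_mat[OF A', of A]
    by (simp add: frob_inner_diff_left[where n=N and m=N] frob_inner_diff_right[where n=N and m=N])
  also have "\<dots> \<le> frobenius_norm (A - A') * p"
    unfolding p_def using A A' P by (intro frob_inner_cauchy_schwarz[of _ N N] minus_carrier_mat)
  finally have "\<alpha> * s \<le> frobenius_norm (A - A') * p" .
  moreover have "\<alpha> * p * p = 2 * (\<alpha> * s)"
    using p2 by (simp add: power2_eq_square mult.assoc)
  ultimately have "\<alpha> * p * p \<le> 2 * frobenius_norm (A - A') * p"
    by linarith
  then have "\<alpha> * p \<le> 2 * frobenius_norm (A - A')"
    using p0 by (cases "p = 0") (auto simp: frobenius_norm_def sum_nonneg)
  then show ?thesis
    using gap by (simp add: p_def P_def P'_def field_simps)
qed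

lemma row_norm_le_frobenius_norm:
  assumes "i < dim_row X"
  shows "vec_norm2 (row X i) \<le> frobenius_norm X"
proof -
  have "row X i \<bullet> row X i = (\<Sum>j<dim_col X. (X $$ (i, j))\<^sup>2)"
    using assms by (simp add: scalar_prod_def atLeast0LessThan power2_eq_square)
  also have "\<dots> \<le> (\<Sum>i<dim_row X. \<Sum>j<dim_col X. (X $$ (i, j))\<^sup>2)"
    using assms by (intro member_le_sum[of i]) (auto intro: sum_nonneg)
  finally show ?thesis by (simp add: vec_norm2_def frobenius_norm_def)
qed

lemma affinity_mat_carrier: "affinity_mat \<sigma> N x \<in> carrier_mat N N"
  by (rule carrier_matI)
     (simp_all add: affinity_mat_def Let_def gaussian_mat_def degree_mat_def diag_inv_sqrt_def
       mat_diag_def)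

theorem corollary6:
  fixes \<sigma> \<alpha> :: real
    and N k :: nat
    and x :: "nat \<Rightarrow> 'a::euclidean_space"
    and x' :: "nat \<Rightarrow> 'b::euclidean_space"
    and A A' V V' Q :: "real mat"
    and lam lam' :: "nat \<Rightarrow> real"
    and v v' :: "nat \<Rightarrow> real vec"
  assumes "\<sigma> > 0"
    and "A = affinity_mat \<sigma> N x"
    and "A' = affinity_mat \<sigma> N x'"
    and "ordered_eigensystem A lam v"
    and "ordered_eigensystem A' lam' v'"
    and "1 \<le> k" and "k < N"
    and "V = top_eigenvectors N k v"
    and "V' = top_eigenvectors N k v'"
    and "\<alpha> > 0"
    and "lam (k - 1) - lam k \<ge> \<alpha>"
    and "lam (k - 1) \<ge> \<alpha>"
    and "is_optimal_alignment k V V' Q"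
  shows "\<forall>i<N. vec_norm2 (row V' i - row_vec_mult (row V i) Q)
                 \<le> (1 + sqrt 2) * (1 / \<alpha>) * frobenius_norm (A - A')"
proof (intro allI impI)
  fix i assume i: "i < N"
  have A: "A \<in> carrier_mat N N" and A': "A' \<in> carrier_mat N N"
    using assms(2,3) by (simp_all add: affinity_mat_carrier)
  have V: "V \<in> carrier_mat N k" "V\<^sup>T * V = 1\<^sub>m k"
    using top_eigenvectors_orthonormal[OF assms(4) A] assms(7,8) by auto
  have V': "V' \<in> carrier_mat N k" "V'\<^sup>T * V' = 1\<^sub>m k"
    using top_eigenvectors_orthonormal[OF assms(5) A'] assms(7,9) by auto
  have Q: "Q \<in> carrier_mat k k"
    using assms(13)
    by (auto simp: is_optimal_alignment_def is_arg_min_def orthogonal_group_mats_def)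
  have "row V' i - row_vec_mult (row V i) Q = row (V' - V * Q) i"
    using V V' Q i by (intro eq_vecI) (auto simp: row_vec_mult_def)
  then have "vec_norm2 (row V' i - row_vec_mult (row V i) Q) \<le> frobenius_norm (V' - V * Q)"
    using row_norm_le_frobenius_norm[of i "V' - V * Q"] V i by simp
  also have "\<dots> \<le> frobenius_norm (V * V\<^sup>T - V' * V'\<^sup>T)"
  proof (rule power2_le_imp_le)
    show "(frobenius_norm (V' - V * Q))\<^sup>2 \<le> (frobenius_norm (V * V\<^sup>T - V' * V'\<^sup>T))\<^sup>2"
      using optimal_alignment_bound[OF V V' assms(13)] projection_distance[OF V V'] by simp
  qed (simp add: frobenius_norm_def sum_nonneg)
  also have "\<dots> \<le> 2 / \<alpha> * frobenius_norm (A - A')"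
    unfolding assms(8,9) using assms(4-7,10,11) A A' by (intro davis_kahan_one_gap)
  also have "\<dots> \<le> (1 + sqrt 2) * (1 / \<alpha>) * frobenius_norm (A - A')"
  proof (rule mult_right_mono)
    show "2 / \<alpha> \<le> (1 + sqrt 2) * (1 / \<alpha>)"
      using assms(10) by (simp add: divide_right_mono)
  qed (simp add: frobenius_norm_def sum_nonneg)
  finally show "vec_norm2 (row V' i - row_vec_mult (row V i) Q)
                 \<le> (1 + sqrt 2) * (1 / \<alpha>) * frobenius_norm (A - A')" .
qed

end
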